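(* Let $\tau_0\in\mathbb{R}$, $0<\alpha\le 1$, and let $\mathfrak{w}:[\tau_0,\infty)\to\Omega$ be an $\alpha_{gH}$-differentiable fuzzy function (with base point $\tau_0$) whose type of $\alpha_{gH}$-differentiability does not change on $[\tau_0,\infty)$. Write $\mathbf{W}_{\alpha}^{\tau_0}(s)=\mathfrak{L}_{\alpha}^{\tau_0}\{\mathfrak{w}(\tau)\}(s)$. Then, for every $s$ for which the transforms involved exist: (1) if $\mathfrak{w}$ is $\alpha_{i.gH}$-differentiable on $[\tau_0,\infty)$, then $$\mathfrak{L}_{\alpha}^{\tau_0}\big\{{}_{i.gH}\mathbf{T}^{\tau_0}_{\alpha}(\mathfrak{w}(\tau))\big\}(s)=s\,\mathbf{W}_{\alpha}^{\tau_0}(s)\ominus \mathfrak{w}(\tau_0);$$ (2) if $\mathfrak{w}$ is $\alpha_{ii.gH}$-differentiable on $[\tau_0,\infty)$, then $$\mathfrak{L}_{\alpha}^{\tau_0}\big\{{}_{ii.gH}\mathbf{T}^{\tau_0}_{\alpha}(\mathfrak{w}(\tau))\big\}(s)=(-1)\mathfrak{w}(\tau_0)\ominus_{gH}(-1)s\,\mathbf{W}_{\alpha}^{\tau_0}(s).$$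
   Context: A fuzzy number is a map $\mathcal{P}:\mathbb{R}\to[0,1]$ that is normal, fuzzy convex, upper semicontinuous and compactly supported; $\mathcal{F}$ is the set of fuzzy numbers. For $r\in(0,1]$, $[\mathcal{P}]^r=\{x:\mathcal{P}(x)\ge r\}$, and $[\mathcal{P}]^0=\overline{\{x:\mathcal{P}(x)>0\}}$; each $[\mathcal{P}]^r=[\mathcal{P}_1(r),\mathcal{P}_2(r)]$ is a compact interval. Addition $\oplus$ and multiplication by real scalars (written $\odot$ or by juxtaposition) are levelwise: $[\mathcal{P}\oplus\mathcal{Q}]^r=[\mathcal{P}]^r+[\mathcal{Q}]^r$, $[c\,\mathcal{P}]^r=c[\mathcal{P}]^r$. $\Omega\subset\mathcal{F}$ is the set of triangular fuzzy numbers $(p_1,p_2,p_3)$, $p_1\le p_2\le p_3$, with $r$-cuts $[p_1+r(p_2-p_1),\,p_3-r(p_3-p_2)]$. The Hukuhara difference $\mathcal{P}\ominus\mathcal{Q}$ is the fuzzy number $\mathcal{R}$ (if it exists) with $\mathcal{P}=\mathcal{Q}\oplus\mathcal{R}$. The generalized Hukuhara difference $\mathcal{P}\ominus_{gH}\mathcal{Q}$ is the fuzzy number $\mathcal{R}$ (if it exists) such that $\mathcal{P}=\mathcal{Q}\oplus\mathcal{R}$ or $\mathcal{Q}=\mathcal{P}\oplus(-1)\mathcal{R}$. Standing assumption: the gH-differences that occur exist and belong to $\Omega$. Limits are taken in the Hausdorff metric $D(\mathcal{P},\mathcal{Q})=\sup_{r\in[0,1]}\max\{|\mathcal{P}_1(r)-\mathcal{Q}_1(r)|,|\mathcal{P}_2(r)-\mathcal{Q}_2(r)|\}$.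 The generalized Hukuhara conformable fractional derivative of order $\alpha$ with base point $\tau_0$ is $${}_{gH}\mathbf{T}^{\tau_0}_{\alpha}(\mathfrak{w}(\tau))=\lim_{\epsilon\to0}\frac{\mathfrak{w}(\tau+\epsilon(\tau-\tau_0)^{1-\alpha})\ominus_{gH}\mathfrak{w}(\tau)}{\epsilon},$$ and $\mathfrak{w}$ is $\alpha_{gH}$-differentiable if this exists in $\mathcal{F}$. For a real-valued $f$, $T^{\tau_0}_\alpha f(\tau)=\lim_{\epsilon\to0}\frac{f(\tau+\epsilon(\tau-\tau_0)^{1-\alpha})-f(\tau)}{\epsilon}$. An $\alpha_{gH}$-differentiable function $\mathfrak{w}=(\mathfrak{w}_1,\mathfrak{w}_2,\mathfrak{w}_3)$ with values in $\Omega$ is $\alpha_{i.gH}$-differentiable at $\tau$ if its derivative there, written ${}_{i.gH}\mathbf{T}^{\tau_0}_\alpha(\mathfrak{w}(\tau))$, equals $(T^{\tau_0}_\alpha\mathfrak{w}_1(\tau),T^{\tau_0}_\alpha\mathfrak{w}_2(\tau),T^{\tau_0}_\alpha\mathfrak{w}_3(\tau))$, and $\alpha_{ii.gH}$-differentiable at $\tau$ if its derivative there, written ${}_{ii.gH}\mathbf{T}^{\tau_0}_\alpha(\mathfrak{w}(\tau))$, equals $(T^{\tau_0}_\alpha\mathfrak{w}_3(\tau),T^{\tau_0}_\alpha\mathfrak{w}_2(\tau),T^{\tau_0}_\alpha\mathfrak{w}_1(\tau))$. The type does not change on an interval if $\mathfrak{w}$ is $\alpha_{i.gH}$-differentiable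 throughout it or $\alpha_{ii.gH}$-differentiable throughout it. Integrals of triangular fuzzy functions are componentwise: $\int_a^b\mathfrak{w}\,d\tau=(\int_a^b\mathfrak{w}_1d\tau,\int_a^b\mathfrak{w}_2d\tau,\int_a^b\mathfrak{w}_3d\tau)$. The fuzzy fractional conformable Laplace transform of order $\alpha$ (with real transform variable $s$) is $$\mathfrak{L}_{\alpha}^{\tau_0}\{\mathfrak{w}(\tau)\}(s)=\int_{\tau_0}^{\infty}(\tau-\tau_0)^{\alpha-1}e^{-s\frac{(\tau-\tau_0)^{\alpha}}{\alpha}}\,\mathfrak{w}(\tau)\,d\tau=\lim_{R\to\infty}\int_{\tau_0}^{R}(\tau-\tau_0)^{\alpha-1}e^{-s\frac{(\tau-\tau_0)^{\alpha}}{\alpha}}\,\mathfrak{w}(\tau)\,d\tau,$$ whenever the limit exists.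
   Formalization: The formal theorem additionally assumes that w is right-continuous at τ0 (not implied when α<1, and the claim fails without it) and, in part (2) only, that s ≥ 0 (the identity fails for s<0 unless w is crisp, a case covered by part (1)). *)

theory Defs
  imports "HOL-Analysis.Analysis"
begin

section \<open>Fuzzy numbers\<close>

definition upper_semicontinuous :: "(real \<Rightarrow> real) \<Rightarrow> bool" where
  "upper_semicontinuous f \<longleftrightarrow> (\<forall>x y. f x < y \<longrightarrow> (\<forall>\<^sub>F z in nhds x. f z < y))"

definition fuzzy_convex :: "(real \<Rightarrow> real) \<Rightarrow> bool" where
  "fuzzy_convex f \<longleftrightarrow>
     (\<forall>x y t. 0 \<le> t \<and> t \<le> 1 \<longrightarrow> min (f x) (f y) \<le> f ((1 - t) * x + t * y))"

typedef fuzzy = "{P :: real \<Rightarrow> real. range P \<subseteq> {0..1} \<and> (\<exists>x. P x = 1) \<and> fuzzy_convex P \<and>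
    upper_semicontinuous P \<and> compact (closure {x. 0 < P x})}"
  morphisms membership Abs_fuzzy
proof
  let ?P = "\<lambda>x::real. if x = 0 then 1 else 0 :: real"
  have "{x. 0 < ?P x} = {0}" by (auto split: if_splits)
  then have "compact (closure {x. 0 < ?P x})" by simp
  moreover have "range ?P \<subseteq> {0..1}" by (simp add: image_subset_iff)
  moreover have "\<exists>x. ?P x = 1" by (rule exI[of _ 0]) simp
  moreover have "fuzzy_convex ?P"
    by (auto simp: fuzzy_convex_def)
  moreover have "upper_semicontinuous ?P"
    unfolding upper_semicontinuous_def
  proof (intro allI impI)
    fix x y :: real assume *: "?P x < y"
    show "\<forall>\<^sub>F z in nhds x. ?P z < y"
    proof (cases "x = 0")
      case True
      then show ?thesis using * by (intro always_eventually) auto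
    next
      case False
      then have nz: "\<forall>\<^sub>F z in nhds x. z \<noteq> 0" by (rule t1_space_nhds)
      show ?thesis by (rule eventually_mono[OF nz]) (use * False in auto)
    qed
  qed
  ultimately show "?P \<in> {P :: real \<Rightarrow> real. range P \<subseteq> {0..1} \<and> (\<exists>x. P x = 1) \<and> fuzzy_convex P \<and>
    upper_semicontinuous P \<and> compact (closure {x. 0 < P x})}" by blast
qed

definition rcut :: "fuzzy \<Rightarrow> real \<Rightarrow> real set" where
  "rcut P r = (if r = 0 then closure {x. 0 < membership P x} else {x. r \<le> membership P x})"

text \<open>The endpoints of the compact interval \<^term>\<open>rcut P r\<close>; see \<open>rcut_eq\<close>.\<close>

definition lo :: "fuzzy \<Rightarrow> real \<Rightarrow> real" where
  "lo P r = Inf (rcut P r)"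

definition hi :: "fuzzy \<Rightarrow> real \<Rightarrow> real" where
  "hi P r = Sup (rcut P r)"

lemma membership_bounds: "0 \<le> membership P x" "membership P x \<le> 1"
proof -
  have "range (membership P) \<subseteq> {0..1}" using membership[of P] by blast
  then show "0 \<le> membership P x" "membership P x \<le> 1" by (simp_all add: image_subset_iff)
qed

lemma membership_normal: "\<exists>x. membership P x = 1"
  using membership[of P] by blast

lemma membership_convex:
  "0 \<le> t \<Longrightarrow> t \<le> 1 \<Longrightarrow>
    min (membership P x) (membership P y) \<le> membership P ((1 - t) * x + t * y)"
  using membership[of P] unfolding fuzzy_convex_def by blast

lemma compact_support: "compact (closure {x. 0 < membership P x})"
  using membership[of P] by blast

lemma closed_level: "closed {x. r \<le> membership P x}"
proof -
  have "open {x. membership P x < r}"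
  proof (subst open_subopen, safe)
    fix x assume "membership P x < r"
    then have "\<forall>\<^sub>F z in nhds x. membership P z < r"
      using membership[of P] unfolding upper_semicontinuous_def by blast
    then show "\<exists>T. open T \<and> x \<in> T \<and> T \<subseteq> {x. membership P x < r}"
      unfolding eventually_nhds by blast
  qed
  moreover have "{x. r \<le> membership P x} = - {x. membership P x < r}" by auto
  ultimately show ?thesis by (simp add: closed_def)
qed

lemma convex_level: "convex {x. r \<le> membership P x}"
proof (rule convexI)
  fix x y u v :: real
  assume *: "x \<in> {x. r \<le> membership P x}" "y \<in> {x. r \<le> membership P x}"
    "0 \<le> u" "0 \<le> v" "u + v = 1"
  then have u: "u = 1 - v" by simp
  then show "u *\<^sub>R x + v *\<^sub>R y \<in> {x. r \<le> membership P x}"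
    using * membership_convex[of v P x y] unfolding u by auto
qed

lemma support_UN: "{x. 0 < membership P x} = (\<Union>r\<in>{0<..1}. rcut P r)"
proof (intro set_eqI iffI)
  fix x assume "x \<in> {x. 0 < membership P x}"
  then show "x \<in> (\<Union>r\<in>{0<..1}. rcut P r)"
    using membership_bounds(2)[of P x] by (intro UN_I[of "membership P x"]) (auto simp: rcut_def)
qed (auto simp: rcut_def)

lemma convex_support: "convex {x. 0 < membership P x}"
proof (rule convexI)
  fix x y u v :: real
  assume *: "x \<in> {x. 0 < membership P x}" "y \<in> {x. 0 < membership P x}"
    "0 \<le> u" "0 \<le> v" "u + v = 1"
  then have u: "u = 1 - v" by simp
  then show "u *\<^sub>R x + v *\<^sub>R y \<in> {x. 0 < membership P x}"
    using * membership_convex[of v P x y] unfolding u by auto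
qed

lemma rcut_antimono:
  assumes "0 \<le> q" "q \<le> r" shows "rcut P r \<subseteq> rcut P q"
  using assms by (auto simp: rcut_def intro!: closure_subset[THEN subsetD])

lemma rcut_nonempty: "r \<le> 1 \<Longrightarrow> rcut P r \<noteq> {}"
proof -
  assume "r \<le> 1"
  obtain x where "membership P x = 1" using membership_normal by blast
  then have "x \<in> rcut P r"
    using \<open>r \<le> 1\<close> by (auto simp: rcut_def intro!: closure_subset[THEN subsetD])
  then show ?thesis by blast
qed

lemma compact_rcut: "0 \<le> r \<Longrightarrow> compact (rcut P r)"
proof (cases "r = 0")
  case True
  then show ?thesis using compact_support by (simp add: rcut_def)
next
  case False
  assume "0 \<le> r"
  have "closed (rcut P r)" using False closed_level by (simp add: rcut_def)
  moreover have "rcut P r \<subseteq> rcut P 0" using \<open>0 \<le> r\<close> by (intro rcut_antimono) auto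
  moreover have "compact (rcut P 0)" using compact_support by (simp add: rcut_def)
  ultimately show ?thesis
    by (metis compact_Int_closed inf.absorb_iff2)
qed

lemma convex_rcut: "convex (rcut P r)"
  by (simp add: rcut_def convex_level convex_support convex_closure)

lemma rcut_eq:
  assumes "0 \<le> r" "r \<le> 1"
  shows "rcut P r = {lo P r..hi P r}" and "lo P r \<le> hi P r"
proof -
  obtain a b where ab: "rcut P r = {a..b}"
    using connected_compact_interval_1[of "rcut P r"] compact_rcut[OF assms(1)]
      convex_connected[OF convex_rcut] by blast
  moreover have "a \<le> b" using rcut_nonempty[OF assms(2), of P] ab by auto
  ultimately show "rcut P r = {lo P r..hi P r}" "lo P r \<le> hi P r"
    by (auto simp: lo_def hi_def)
qed

lemma fuzzy_eqI:
  assumes "\<And>r. 0 \<le> r \<Longrightarrow> r \<le> 1 \<Longrightarrow> rcut P r = rcut Q r"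
  shows "P = Q"
proof -
  have le: "membership A x \<le> membership B x"
    if "\<And>r. 0 \<le> r \<Longrightarrow> r \<le> 1 \<Longrightarrow> rcut A r = rcut B r" for A B x
  proof (cases "membership A x = 0")
    case True
    then show ?thesis using membership_bounds by simp
  next
    case False
    have "x \<in> rcut A (membership A x)" using False by (simp add: rcut_def)
    then show ?thesis using False that[of "membership A x"] membership_bounds[of A x]
      by (auto simp: rcut_def split: if_splits)
  qed
  have "membership P = membership Q"
    using le[of P Q] le[of Q P] assms by (intro ext antisym) auto
  then show ?thesis by (simp add: membership_inject)
qed

lemma rcut_left_continuous:
  assumes "0 < r" "\<And>q. 0 < q \<Longrightarrow> q < r \<Longrightarrow> x \<in> rcut P q"
  shows "x \<in> rcut P r"
proof -
  have "r \<le> membership P x"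
  proof (rule dense_le_bounded[OF assms(1)])
    fix w assume "0 < w" "w < r"
    then show "w \<le> membership P x" using assms(2)[of w] by (simp add: rcut_def)
  qed
  then show ?thesis using assms(1) by (simp add: rcut_def)
qed

text \<open>The representation theorem for fuzzy numbers by their level sets. It makes the
  levelwise definitions below meaningful.\<close>

lemma fuzzy_of_cuts:
  fixes S :: "real \<Rightarrow> real set"
  assumes ne: "S 1 \<noteq> {}"
    and cl: "\<And>r. 0 < r \<Longrightarrow> r \<le> 1 \<Longrightarrow> closed (S r)"
    and cv: "\<And>r. 0 < r \<Longrightarrow> r \<le> 1 \<Longrightarrow> convex (S r)"
    and anti: "\<And>q r. 0 < q \<Longrightarrow> q \<le> r \<Longrightarrow> r \<le> 1 \<Longrightarrow> S r \<subseteq> S q"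
    and left: "\<And>r x. 0 < r \<Longrightarrow> r \<le> 1 \<Longrightarrow> (\<And>q. 0 < q \<Longrightarrow> q < r \<Longrightarrow> x \<in> S q) \<Longrightarrow> x \<in> S r"
    and zero: "S 0 = closure (\<Union>r\<in>{0<..1}. S r)" "compact (S 0)"
  shows "\<exists>!P. \<forall>r\<in>{0..1}. rcut P r = S r"
proof -
  define A where "A x = insert 0 {r \<in> {0<..1}. x \<in> S r}" for x
  define f where "f x = Sup (A x)" for x
  have bdd: "bdd_above (A x)" for x
    by (rule bdd_aboveI[of _ 1]) (auto simp: A_def)
  have f0: "0 \<le> f x" for x
    unfolding f_def by (rule cSup_upper[OF _ bdd]) (simp add: A_def)
  have f1: "f x \<le> 1" for x
    unfolding f_def by (rule cSup_least) (auto simp: A_def)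
  have lev: "r \<le> f x \<longleftrightarrow> x \<in> S r" if r: "0 < r" "r \<le> 1" for r x
  proof
    assume "x \<in> S r"
    then show "r \<le> f x" unfolding f_def
      using r by (intro cSup_upper[OF _ bdd]) (auto simp: A_def)
  next
    assume *: "r \<le> f x"
    show "x \<in> S r"
    proof (rule left[OF r])
      fix q assume q: "0 < q" "q < r"
      then have "q < Sup (A x)" using * by (simp add: f_def)
      then obtain r' where "r' \<in> A x" "q < r'"
        using less_cSup_iff[OF _ bdd, of x q] by (auto simp: A_def)
      then show "x \<in> S q" using q anti[of q r'] by (auto simp: A_def)
    qed
  qed
  have supp: "{x. 0 < f x} = (\<Union>r\<in>{0<..1}. S r)"
  proof (intro set_eqI iffI)
    fix x assume "x \<in> {x. 0 < f x}"
    then show "x \<in> (\<Union>r\<in>{0<..1}. S r)" using lev[of "f x" x] f1[of x] by auto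
  next
    fix x assume "x \<in> (\<Union>r\<in>{0<..1}. S r)"
    then obtain r where "0 < r" "r \<le> 1" "x \<in> S r" by auto
    then show "x \<in> {x. 0 < f x}" using lev[of r x] by auto
  qed
  have "fuzzy_convex f" unfolding fuzzy_convex_def
  proof (intro allI impI)
    fix x y t :: real assume t: "0 \<le> t \<and> t \<le> 1"
    define m where "m = min (f x) (f y)"
    have "m \<le> f ((1 - t) * x + t * y)"
    proof (cases "m = 0")
      case True
      then show ?thesis using f0 by simp
    next
      case False
      then have m: "0 < m" "m \<le> 1"
        using f0[of x] f0[of y] f1[of x] unfolding m_def by linarith+
      have "m \<le> f x" "m \<le> f y" unfolding m_def by simp_all
      then have "x \<in> S m" "y \<in> S m" using lev[OF m] by blast+
      then have "(1 - t) * x + t * y \<in> S m"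
        using convexD[OF cv[OF m], of x y "1 - t" t] t by simp
      then show ?thesis using lev[OF m] by blast
    qed
    then show "min (f x) (f y) \<le> f ((1 - t) * x + t * y)" unfolding m_def .
  qed
  moreover have "upper_semicontinuous f" unfolding upper_semicontinuous_def
  proof (intro allI impI)
    fix x y assume *: "f x < y"
    show "\<forall>\<^sub>F z in nhds x. f z < y"
    proof (cases "y \<le> 1")
      case True
      have y: "0 < y" using * f0[of x] by linarith
      have "x \<in> - S y" using lev[OF y True, of x] * by simp
      then have ev: "\<forall>\<^sub>F z in nhds x. z \<in> - S y"
        using cl[OF y True] by (intro eventually_nhds_in_open open_Compl)
      show ?thesis
      proof (rule eventually_mono[OF ev])
        fix z assume "z \<in> - S y"
        then show "f z < y" using lev[OF y True, of z] by simp
      qed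
    next
      case False
      have "f z < y" for z using f1[of z] False by linarith
      then show ?thesis by simp
    qed
  qed
  moreover have "\<exists>x. f x = 1"
  proof -
    obtain x where "x \<in> S 1" using ne by blast
    then have "f x = 1" using lev[of 1 x] f1[of x] by auto
    then show ?thesis ..
  qed
  moreover have "range f \<subseteq> {0..1}" using f0 f1 by auto
  moreover have "compact (closure {x. 0 < f x})" using zero supp by simp
  ultimately have mem: "membership (Abs_fuzzy f) = f"
    by (intro Abs_fuzzy_inverse) simp
  have "\<forall>r\<in>{0..1}. rcut (Abs_fuzzy f) r = S r"
    using lev zero supp by (auto simp: rcut_def mem)
  then show ?thesis by (intro ex1I[of _ "Abs_fuzzy f"] fuzzy_eqI) auto
qed

section \<open>Levelwise arithmetic and triangular fuzzy numbers\<close>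

definition fuzzy_add :: "fuzzy \<Rightarrow> fuzzy \<Rightarrow> fuzzy" (infixl "\<oplus>" 65) where
  "P \<oplus> Q = (THE R. \<forall>r\<in>{0..1}. rcut R r = {x + y |x y. x \<in> rcut P r \<and> y \<in> rcut Q r})"

definition fuzzy_scale :: "real \<Rightarrow> fuzzy \<Rightarrow> fuzzy" (infixr "\<odot>" 75) where
  "c \<odot> P = (THE R. \<forall>r\<in>{0..1}. rcut R r = (\<lambda>x. c * x) ` rcut P r)"

text \<open>Only meaningful for \<open>p1 \<le> p2 \<le> p3\<close>; every use below is guarded accordingly.\<close>

definition tri :: "real \<Rightarrow> real \<Rightarrow> real \<Rightarrow> fuzzy" where
  "tri p1 p2 p3 =
     (THE P. \<forall>r\<in>{0..1}. rcut P r = {p1 + r * (p2 - p1)..p3 - r * (p3 - p2)})"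

definition Triangular :: "fuzzy set" where
  "Triangular = {tri p1 p2 p3 |p1 p2 p3. p1 \<le> p2 \<and> p2 \<le> p3}"

lemma rcut_fuzzy_add:
  assumes "r \<in> {0..1}"
  shows "rcut (P \<oplus> Q) r = {x + y |x y. x \<in> rcut P r \<and> y \<in> rcut Q r}"
proof -
  let ?S = "\<lambda>r. {x + y |x y. x \<in> rcut P r \<and> y \<in> rcut Q r}"
  have comp: "compact (?S r)" if "0 \<le> r" for r
    using compact_sums[OF compact_rcut[OF that] compact_rcut[OF that]] .
  have "\<exists>!R. \<forall>r\<in>{0..1}. rcut R r = ?S r"
  proof (rule fuzzy_of_cuts)
    show "?S 1 \<noteq> {}" using rcut_nonempty[of 1 P] rcut_nonempty[of 1 Q] by blast
    show "closed (?S r)" if "0 < r" for r using comp that by (auto intro: compact_imp_closed)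
    show "convex (?S r)" for r
    proof -
      have "?S r = (\<Union>x\<in>rcut P r. \<Union>y\<in>rcut Q r. {x + y})" by auto
      then show ?thesis using convex_sums[OF convex_rcut[of P r] convex_rcut[of Q r]] by simp
    qed
    show "?S r \<subseteq> ?S q" if "0 < q" "q \<le> r" for q r
      using rcut_antimono[of q r P] rcut_antimono[of q r Q] that by fastforce
    show "x \<in> ?S r" if r: "0 < r" "r \<le> 1" and x: "\<And>q. 0 < q \<Longrightarrow> q < r \<Longrightarrow> x \<in> ?S q" for r x
    proof -
      define K where "K q = rcut P q \<inter> (\<lambda>p. x - p) ` rcut Q q" for q
      have "compact (K q)" if "q \<in> {0<..<r}" for q
        unfolding K_def using that
        by (intro compact_Int compact_continuous_image compact_rcut continuous_intros) auto
      moreover have "\<Inter>(K ` J) \<noteq> {}" if J: "finite J" "J \<subseteq> {0<..<r}" for J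
      proof (cases "J = {}")
        case False
        define q where "q = Max J"
        have q: "0 < q" "q < r" using Max_in[OF J(1) False] J(2) unfolding q_def by auto
        have qj: "j \<le> q" "0 \<le> j" if "j \<in> J" for j
          using that J by (auto simp: q_def)
        obtain y z where yz: "x = y + z" "y \<in> rcut P q" "z \<in> rcut Q q" using x[OF q] by blast
        have "y \<in> K j" if "j \<in> J" for j
        proof -
          have "y \<in> rcut P j" "z \<in> rcut Q j"
            using rcut_antimono[OF qj(2)[OF that] qj(1)[OF that]] yz by auto
          then show ?thesis unfolding K_def using yz(1) by (auto intro!: image_eqI[of _ _ z])
        qed
        then show ?thesis by blast
      qed auto
      ultimately have "\<Inter>(K ` {0<..<r}) \<noteq> {}"
      proof -
        assume c: "\<And>q. q \<in> {0<..<r} \<Longrightarrow> compact (K q)"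
          and f: "\<And>J. finite J \<Longrightarrow> J \<subseteq> {0<..<r} \<Longrightarrow> \<Inter>(K ` J) \<noteq> {}"
        have "rcut P 0 \<inter> \<Inter>(K ` {0<..<r}) \<noteq> {}"
        proof (rule compact_imp_fip_image)
          show "compact (rcut P 0)" by (rule compact_rcut) simp
          show "closed (K q)" if "q \<in> {0<..<r}" for q using c[OF that] by (rule compact_imp_closed)
          fix J assume J: "finite J" "J \<subseteq> {0<..<r}"
          let ?J = "insert (r/2) J"
          have "?J \<subseteq> {0<..<r}" using J r by auto
          then have "\<Inter>(K ` ?J) \<noteq> {}" using J by (intro f) auto
          moreover have "K (r/2) \<subseteq> rcut P 0"
            unfolding K_def using rcut_antimono[of 0 "r/2" P] r by auto
          ultimately show "rcut P 0 \<inter> \<Inter>(K ` J) \<noteq> {}" by auto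
        qed
        then show ?thesis by blast
      qed
      then obtain y where "y \<in> \<Inter>(K ` {0<..<r})" by blast
      then have y: "y \<in> K q" if "0 < q" "q < r" for q using that by simp
      have "y \<in> rcut P r"
      proof (rule rcut_left_continuous[OF r(1)])
        fix q assume "0 < q" "q < r"
        then have "y \<in> K q" by (rule y)
        then show "y \<in> rcut P q" by (simp add: K_def)
      qed
      moreover have "x - y \<in> rcut Q r"
      proof (rule rcut_left_continuous[OF r(1)])
        fix q assume "0 < q" "q < r"
        then have "y \<in> K q" by (rule y)
        then show "x - y \<in> rcut Q q" by (auto simp: K_def)
      qed
      moreover have "x = y + (x - y)" by simp
      ultimately show ?thesis by blast
    qed
    show "compact (?S 0)" by (rule comp) simp
    show "?S 0 = closure (\<Union>r\<in>{0<..1}. ?S r)"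
    proof -
      let ?A = "{x. 0 < membership P x}" and ?B = "{x. 0 < membership Q x}"
      let ?f = "\<lambda>z::real\<times>real. fst z + snd z"
      have S0: "?S 0 = ?f ` closure (?A \<times> ?B)"
        by (force simp: rcut_def closure_Times)
      have U: "(\<Union>r\<in>{0<..1}. ?S r) = ?f ` (?A \<times> ?B)"
      proof (intro set_eqI iffI)
        fix z assume "z \<in> (\<Union>r\<in>{0<..1}. ?S r)"
        then show "z \<in> ?f ` (?A \<times> ?B)" unfolding support_UN by force
      next
        fix z assume "z \<in> ?f ` (?A \<times> ?B)"
        then obtain x y where *: "z = x + y" "0 < membership P x" "0 < membership Q y" by auto
        let ?r = "min (membership P x) (membership Q y)"
        have "?r \<in> {0<..1}" "x \<in> rcut P ?r" "y \<in> rcut Q ?r"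
          using * membership_bounds(2)[of P x] by (auto simp: rcut_def)
        then show "z \<in> (\<Union>r\<in>{0<..1}. ?S r)" using *(1) by blast
      qed
      have "?f ` closure (?A \<times> ?B) = closure (?f ` (?A \<times> ?B))"
      proof (rule antisym)
        show "?f ` closure (?A \<times> ?B) \<subseteq> closure (?f ` (?A \<times> ?B))"
          by (intro image_closure_subset continuous_intros closure_subset) auto
        show "closure (?f ` (?A \<times> ?B)) \<subseteq> ?f ` closure (?A \<times> ?B)"
        proof (rule closure_minimal)
          show "?f ` (?A \<times> ?B) \<subseteq> ?f ` closure (?A \<times> ?B)"
            by (intro image_mono closure_subset)
          show "closed (?f ` closure (?A \<times> ?B))"
            using comp[of 0] S0 by (metis compact_imp_closed order_refl)
        qed
      qed
      then show ?thesis using S0 U by simp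
    qed
  qed
  from theI'[OF this] show ?thesis using assms unfolding fuzzy_add_def by blast
qed

lemma rcut_fuzzy_scale:
  assumes "r \<in> {0..1}"
  shows "rcut (c \<odot> P) r = (\<lambda>x. c * x) ` rcut P r"
proof -
  let ?S = "\<lambda>r. (\<lambda>x. c * x) ` rcut P r"
  have comp: "compact (?S r)" if "0 \<le> r" for r
    using that by (intro compact_continuous_image compact_rcut continuous_intros)
  have "\<exists>!R. \<forall>r\<in>{0..1}. rcut R r = ?S r"
  proof (rule fuzzy_of_cuts)
    show "?S 1 \<noteq> {}" using rcut_nonempty[of 1 P] by simp
    show "closed (?S r)" if "0 < r" for r using comp that by (auto intro: compact_imp_closed)
    show "convex (?S r)" for r using convex_scaling[OF convex_rcut, of c P r] by simp
    show "?S r \<subseteq> ?S q" if "0 < q" "q \<le> r" for q r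
      using rcut_antimono[of q r P] that by fastforce
    show "compact (?S 0)" by (rule comp) simp
    show "?S 0 = closure (\<Union>r\<in>{0<..1}. ?S r)"
    proof -
      have "(\<Union>r\<in>{0<..1}. ?S r) = (\<lambda>x. c *\<^sub>R x) ` {x. 0 < membership P x}"
        unfolding support_UN by auto
      then show ?thesis
        using closure_scaleR[of c "{x. 0 < membership P x}"] by (simp add: rcut_def)
    qed
    show "x \<in> ?S r" if r: "0 < r" "r \<le> 1" and x: "\<And>q. 0 < q \<Longrightarrow> q < r \<Longrightarrow> x \<in> ?S q" for r x
    proof (cases "c = 0")
      case True
      have "x = 0" using x[of "r/2"] r True by auto
      then show ?thesis using True rcut_nonempty[OF r(2), of P] by auto
    next
      case False
      have "x / c \<in> rcut P r"
      proof (rule rcut_left_continuous[OF r(1)])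
        fix q assume "0 < q" "q < r"
        then have "x \<in> ?S q" by (rule x)
        then show "x / c \<in> rcut P q" using False by auto
      qed
      then show ?thesis using False by (intro image_eqI[of _ _ "x / c"]) auto
    qed
  qed
  from theI'[OF this] show ?thesis using assms unfolding fuzzy_scale_def by blast
qed

lemma rcut_tri:
  assumes p: "p1 \<le> p2" "p2 \<le> p3" and r: "r \<in> {0..1}"
  shows "rcut (tri p1 p2 p3) r = {p1 + r * (p2 - p1)..p3 - r * (p3 - p2)}"
proof -
  let ?S = "\<lambda>r. {p1 + r * (p2 - p1)..p3 - r * (p3 - p2)}"
  have anti: "?S r \<subseteq> ?S q" if "q \<le> r" for q r
    using mult_right_mono[OF that, of "p2 - p1"] mult_right_mono[OF that, of "p3 - p2"] p by auto
  have "\<exists>!R. \<forall>r\<in>{0..1}. rcut R r = ?S r"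
  proof (rule fuzzy_of_cuts)
    show "?S 1 \<noteq> {}" by simp
    show "?S r \<subseteq> ?S q" if "q \<le> r" for q r using anti[OF that] .
    show "x \<in> ?S r" if r: "0 < r" "r \<le> 1" and x: "\<And>q. 0 < q \<Longrightarrow> q < r \<Longrightarrow> x \<in> ?S q" for r x
    proof -
      have ev: "\<forall>\<^sub>F q in at_left r. x \<in> ?S q"
        using eventually_at_left_real[OF r(1)] by eventually_elim (use x in auto)
      have "((\<lambda>q. p1 + q * (p2 - p1)) \<longlongrightarrow> p1 + r * (p2 - p1)) (at_left r)"
        "((\<lambda>q. p3 - q * (p3 - p2)) \<longlongrightarrow> p3 - r * (p3 - p2)) (at_left r)"
        by (intro tendsto_intros)+
      then have "p1 + r * (p2 - p1) \<le> x" "x \<le> p3 - r * (p3 - p2)"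
        by (auto elim!: tendsto_upperbound tendsto_lowerbound intro: eventually_mono[OF ev])
      then show ?thesis by simp
    qed
    show "?S 0 = closure (\<Union>r\<in>{0<..1}. ?S r)"
    proof (rule antisym)
      show "closure (\<Union>r\<in>{0<..1}. ?S r) \<subseteq> ?S 0"
      proof (rule closure_minimal)
        show "(\<Union>r\<in>{0<..1}. ?S r) \<subseteq> ?S 0"
        proof (rule UN_least)
          fix r :: real assume "r \<in> {0<..1}"
          then show "?S r \<subseteq> ?S 0" by (intro anti) auto
        qed
      qed simp
      show "?S 0 \<subseteq> closure (\<Union>r\<in>{0<..1}. ?S r)"
      proof
        fix x assume x: "x \<in> ?S 0"
        have "((\<lambda>r. x + r * (p2 - x)) \<longlongrightarrow> x + 0 * (p2 - x)) (at_right 0)"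
          by (intro tendsto_intros)
        moreover have "\<forall>\<^sub>F r in at_right 0. x + r * (p2 - x) \<in> (\<Union>r\<in>{0<..1}. ?S r)"
        proof (rule eventually_mono[OF eventually_at_right_real[OF zero_less_one]])
          fix r :: real assume "r \<in> {0<..<1}"
          then have r: "0 < r" "r < 1" by auto
          have "(1 - r) * p1 \<le> (1 - r) * x" "(1 - r) * x \<le> (1 - r) * p3"
            using x r by (auto intro!: mult_left_mono)
          then have "x + r * (p2 - x) \<in> ?S r" by (simp add: algebra_simps)
          moreover have "r \<in> {0<..1}" using r by auto
          ultimately show "x + r * (p2 - x) \<in> (\<Union>r\<in>{0<..1}. ?S r)" by blast
        qed
        then have "\<forall>\<^sub>F r in at_right 0. x + r * (p2 - x) \<in> closure (\<Union>r\<in>{0<..1}. ?S r)"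
          by (rule eventually_mono) (rule closure_subset[THEN subsetD])
        ultimately show "x \<in> closure (\<Union>r\<in>{0<..1}. ?S r)"
          using Lim_in_closed_set[OF closed_closure _ trivial_limit_at_right_real] by fastforce
      qed
    qed
  qed auto
  from theI'[OF this] show ?thesis using r unfolding tri_def by blast
qed

section \<open>The Hausdorff metric on fuzzy numbers\<close>

lemma bdd_above_dist:
  "bdd_above ((\<lambda>r. max \<bar>lo P r - lo Q r\<bar> \<bar>hi P r - hi Q r\<bar>) ` {0..1})"
proof -
  have *: "lo P 0 \<le> lo P r" "hi P r \<le> hi P 0" "lo P r \<le> hi P r" if "r \<in> {0..1}" for P r
    using rcut_antimono[of 0 r P] rcut_eq[of r P] rcut_eq[of 0 P] that by auto
  show ?thesis
  proof (rule bdd_aboveI2)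
    fix r :: real assume "r \<in> {0..1}"
    then show "max \<bar>lo P r - lo Q r\<bar> \<bar>hi P r - hi Q r\<bar> \<le>
        \<bar>lo P 0\<bar> + \<bar>hi P 0\<bar> + \<bar>lo Q 0\<bar> + \<bar>hi Q 0\<bar>"
      using *[of r P] *[of r Q] by auto
  qed
qed

instantiation fuzzy :: metric_space
begin

definition dist_fuzzy :: "fuzzy \<Rightarrow> fuzzy \<Rightarrow> real" where
  "dist P Q = (SUP r\<in>{0..1}. max \<bar>lo P r - lo Q r\<bar> \<bar>hi P r - hi Q r\<bar>)"

definition uniformity_fuzzy :: "(fuzzy \<times> fuzzy) filter" where
  "uniformity_fuzzy = (INF e\<in>{0<..}. principal {(P, Q). dist P Q < e})"

definition open_fuzzy :: "fuzzy set \<Rightarrow> bool" where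
  "open_fuzzy U \<longleftrightarrow> (\<forall>P\<in>U. eventually (\<lambda>(P', Q). P' = P \<longrightarrow> Q \<in> U) uniformity)"

instance
proof
  have up: "\<bar>lo P r - lo Q r\<bar> \<le> dist P Q" "\<bar>hi P r - hi Q r\<bar> \<le> dist P Q"
    if "r \<in> {0..1}" for P Q :: fuzzy and r
    using cSUP_upper[OF that bdd_above_dist, of P Q] unfolding dist_fuzzy_def by auto
  fix P Q R :: fuzzy
  show "dist P Q = 0 \<longleftrightarrow> P = Q"
  proof
    assume 0: "dist P Q = 0"
    show "P = Q"
    proof (rule fuzzy_eqI)
      fix r :: real assume r: "0 \<le> r" "r \<le> 1"
      show "rcut P r = rcut Q r" using up[of r P Q] r 0 by (simp add: rcut_eq)
    qed
  qed (simp add: dist_fuzzy_def)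
  show "dist P Q \<le> dist P R + dist Q R"
    unfolding dist_fuzzy_def[of P Q]
  proof (rule cSUP_least)
    fix r :: real assume "r \<in> {0..1}"
    then show "max \<bar>lo P r - lo Q r\<bar> \<bar>hi P r - hi Q r\<bar> \<le> dist P R + dist Q R"
      using up[of r P R] up[of r Q R] by linarith
  qed simp
qed (rule uniformity_fuzzy_def open_fuzzy_def)+

end

section \<open>Hukuhara differences\<close>

definition H_diff_exists :: "fuzzy \<Rightarrow> fuzzy \<Rightarrow> bool" where
  "H_diff_exists P Q \<longleftrightarrow> (\<exists>R. P = Q \<oplus> R)"

definition H_diff :: "fuzzy \<Rightarrow> fuzzy \<Rightarrow> fuzzy" (infixl "\<ominus>" 65) where
  "P \<ominus> Q = (THE R. P = Q \<oplus> R)"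

definition gH_diff_exists :: "fuzzy \<Rightarrow> fuzzy \<Rightarrow> bool" where
  "gH_diff_exists P Q \<longleftrightarrow> (\<exists>R. P = Q \<oplus> R \<or> Q = P \<oplus> (-1) \<odot> R)"

definition gH_diff :: "fuzzy \<Rightarrow> fuzzy \<Rightarrow> fuzzy" (infixl "\<ominus>\<^sub>g\<^sub>H" 65) where
  "P \<ominus>\<^sub>g\<^sub>H Q = (THE R. P = Q \<oplus> R \<or> Q = P \<oplus> (-1) \<odot> R)"

lemma lo_hi_eqI:
  assumes "rcut P r = {a..b}" "a \<le> b" shows "lo P r = a" "hi P r = b"
  using assms by (auto simp: lo_def hi_def)

lemma lo_hi_add:
  assumes "r \<in> {0..1}"
  shows "lo (P \<oplus> Q) r = lo P r + lo Q r" "hi (P \<oplus> Q) r = hi P r + hi Q r"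
proof -
  have r: "0 \<le> r" "r \<le> 1" using assms by auto
  note [simp] = rcut_eq(2)[OF r]
  have "{x + y |x y. x \<in> rcut P r \<and> y \<in> rcut Q r} = {lo P r + lo Q r..hi P r + hi Q r}"
    (is "?S = ?I")
  proof (intro antisym subsetI)
    fix z assume "z \<in> ?S" then show "z \<in> ?I" by (auto simp: rcut_eq[OF r] intro: add_mono)
  next
    fix z assume z: "z \<in> ?I"
    let ?x = "max (lo P r) (z - hi Q r)"
    have "?x \<in> rcut P r" "z - ?x \<in> rcut Q r" using z rcut_eq(2)[OF r, of P] rcut_eq(2)[OF r, of Q]
      unfolding rcut_eq[OF r] by (auto simp: max_def)
    then show "z \<in> ?S" by (intro CollectI exI[of _ ?x] exI[of _ "z - ?x"]) simp
  qed
  then have "rcut (P \<oplus> Q) r = ?I" using rcut_fuzzy_add[OF assms] by simp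
  from lo_hi_eqI[OF this] show "lo (P \<oplus> Q) r = lo P r + lo Q r" "hi (P \<oplus> Q) r = hi P r + hi Q r"
    by (simp_all add: add_mono)
qed

lemma lo_hi_uminus:
  assumes "r \<in> {0..1}"
  shows "lo ((-1) \<odot> P) r = - hi P r" "hi ((-1) \<odot> P) r = - lo P r"
proof -
  have r: "0 \<le> r" "r \<le> 1" using assms by auto
  have "rcut ((-1) \<odot> P) r = {- hi P r..- lo P r}"
    using rcut_fuzzy_scale[OF assms, of "-1" P] by (simp add: rcut_eq[OF r])
  from lo_hi_eqI[OF this] show "lo ((-1) \<odot> P) r = - hi P r" "hi ((-1) \<odot> P) r = - lo P r"
    using rcut_eq(2)[OF r, of P] by auto
qed

lemma fuzzy_eq_lo_hi:
  assumes "\<And>r. r \<in> {0..1} \<Longrightarrow> lo P r = lo Q r \<and> hi P r = hi Q r" shows "P = Q"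
  by (rule fuzzy_eqI) (simp add: rcut_eq assms)

lemma H_diff_eqI:
  assumes "P = Q \<oplus> R" shows "P \<ominus> Q = R"
  unfolding H_diff_def
proof (rule the_equality[of "\<lambda>R. P = Q \<oplus> R", OF assms])
  fix S assume "P = Q \<oplus> S"
  then show "S = R" using assms lo_hi_add[of _ Q R] lo_hi_add[of _ Q S]
    by (intro fuzzy_eq_lo_hi) (metis add_left_cancel)
qed

lemma gH_diff_eqI:
  assumes "P = Q \<oplus> R \<or> Q = P \<oplus> (-1) \<odot> R" shows "P \<ominus>\<^sub>g\<^sub>H Q = R"
  unfolding gH_diff_def
proof (rule the_equality[of "\<lambda>R. P = Q \<oplus> R \<or> Q = P \<oplus> (-1) \<odot> R", OF assms])
  have aux: "lo P r = lo Q r + lo S r \<and> hi P r = hi Q r + hi S r \<or>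
      lo Q r = lo P r - hi S r \<and> hi Q r = hi P r - lo S r"
    if "P = Q \<oplus> S \<or> Q = P \<oplus> (-1) \<odot> S" "r \<in> {0..1}" for S r
    using that lo_hi_add[OF that(2), of Q S] lo_hi_add[OF that(2), of P "(-1) \<odot> S"]
      lo_hi_uminus[OF that(2), of S] by auto
  fix S assume S: "P = Q \<oplus> S \<or> Q = P \<oplus> (-1) \<odot> S"
  show "S = R"
  proof (rule fuzzy_eq_lo_hi)
    fix r :: real assume r: "r \<in> {0..1}"
    then have "lo S r \<le> hi S r" "lo R r \<le> hi R r" by (auto intro: rcut_eq)
    then show "lo S r = lo R r \<and> hi S r = hi R r"
      using aux[OF S r] aux[OF assms r] by linarith
  qed
qed

section \<open>Conformable derivatives\<close>

text \<open>The factor \<open>(\<tau> - \<tau>\<^sub>0)\<^bsup>1 - \<alpha>\<^esup>\<close>. For \<open>\<alpha> = 1\<close> it is \<open>1\<close> even at \<open>\<tau> = \<tau>\<^sub>0\<close>, whereas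
  \<open>0 powr 0 = 0\<close> in the library.\<close>

definition conf_factor :: "real \<Rightarrow> real \<Rightarrow> real \<Rightarrow> real" where
  "conf_factor \<tau>0 \<alpha> \<tau> = (if \<alpha> = 1 then 1 else (\<tau> - \<tau>0) powr (1 - \<alpha>))"

text \<open>The functions live on \<open>[\<tau>\<^sub>0, \<infinity>)\<close>, so the increments \<open>\<epsilon> \<rightarrow> 0\<close> are those that keep the argument
  in this domain. This is a restriction only for \<open>\<alpha> = 1\<close>, \<open>\<tau> = \<tau>\<^sub>0\<close>, where it gives the
  one-sided derivative.\<close>

definition conf_filter :: "real \<Rightarrow> real \<Rightarrow> real \<Rightarrow> real filter" where
  "conf_filter \<tau>0 \<alpha> \<tau> = at 0 within {\<epsilon>. \<tau>0 \<le> \<tau> + \<epsilon> * conf_factor \<tau>0 \<alpha> \<tau>}"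

definition has_conf_deriv ::
    "real \<Rightarrow> real \<Rightarrow> (real \<Rightarrow> real) \<Rightarrow> real \<Rightarrow> real \<Rightarrow> bool" where
  "has_conf_deriv \<tau>0 \<alpha> f \<tau> l \<longleftrightarrow>
     ((\<lambda>\<epsilon>. (f (\<tau> + \<epsilon> * conf_factor \<tau>0 \<alpha> \<tau>) - f \<tau>) / \<epsilon>) \<longlongrightarrow> l) (conf_filter \<tau>0 \<alpha> \<tau>)"

definition conf_deriv :: "real \<Rightarrow> real \<Rightarrow> (real \<Rightarrow> real) \<Rightarrow> real \<Rightarrow> real" where
  "conf_deriv \<tau>0 \<alpha> f \<tau> = (THE l. has_conf_deriv \<tau>0 \<alpha> f \<tau> l)"

definition has_gH_deriv ::
    "real \<Rightarrow> real \<Rightarrow> (real \<Rightarrow> fuzzy) \<Rightarrow> real \<Rightarrow> fuzzy \<Rightarrow> bool" where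
  "has_gH_deriv \<tau>0 \<alpha> w \<tau> L \<longleftrightarrow>
     (\<forall>\<^sub>F \<epsilon> in conf_filter \<tau>0 \<alpha> \<tau>.
        gH_diff_exists (w (\<tau> + \<epsilon> * conf_factor \<tau>0 \<alpha> \<tau>)) (w \<tau>)) \<and>
     ((\<lambda>\<epsilon>. (1 / \<epsilon>) \<odot> (w (\<tau> + \<epsilon> * conf_factor \<tau>0 \<alpha> \<tau>) \<ominus>\<^sub>g\<^sub>H w \<tau>)) \<longlongrightarrow> L)
       (conf_filter \<tau>0 \<alpha> \<tau>)"

definition gH_differentiable :: "real \<Rightarrow> real \<Rightarrow> (real \<Rightarrow> fuzzy) \<Rightarrow> real \<Rightarrow> bool" where
  "gH_differentiable \<tau>0 \<alpha> w \<tau> \<longleftrightarrow> (\<exists>L. has_gH_deriv \<tau>0 \<alpha> w \<tau> L)"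

definition gH_deriv :: "real \<Rightarrow> real \<Rightarrow> (real \<Rightarrow> fuzzy) \<Rightarrow> real \<Rightarrow> fuzzy" where
  "gH_deriv \<tau>0 \<alpha> w \<tau> = (THE L. has_gH_deriv \<tau>0 \<alpha> w \<tau> L)"

text \<open>The components of a triangular fuzzy number: \<open>P = tri (comp1 P) (comp2 P) (comp3 P)\<close>.\<close>

definition comp1 :: "fuzzy \<Rightarrow> real" where "comp1 P = lo P 0"
definition comp2 :: "fuzzy \<Rightarrow> real" where "comp2 P = lo P 1"
definition comp3 :: "fuzzy \<Rightarrow> real" where "comp3 P = hi P 0"

lemma comp_tri:
  assumes "p1 \<le> p2" "p2 \<le> p3"
  shows "comp1 (tri p1 p2 p3) = p1" "comp2 (tri p1 p2 p3) = p2" "comp3 (tri p1 p2 p3) = p3"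
  using rcut_tri[OF assms, of 0] rcut_tri[OF assms, of 1] assms
  by (auto simp: comp1_def comp2_def comp3_def lo_def hi_def)

definition components_conf_differentiable ::
    "real \<Rightarrow> real \<Rightarrow> (real \<Rightarrow> fuzzy) \<Rightarrow> real \<Rightarrow> bool" where
  "components_conf_differentiable \<tau>0 \<alpha> w \<tau> \<longleftrightarrow>
     (\<forall>c\<in>{comp1, comp2, comp3}. \<exists>l. has_conf_deriv \<tau>0 \<alpha> (\<lambda>t. c (w t)) \<tau> l)"

definition i_gH_differentiable :: "real \<Rightarrow> real \<Rightarrow> (real \<Rightarrow> fuzzy) \<Rightarrow> real \<Rightarrow> bool" where
  "i_gH_differentiable \<tau>0 \<alpha> w \<tau> \<longleftrightarrow>
     gH_differentiable \<tau>0 \<alpha> w \<tau> \<and> components_conf_differentiable \<tau>0 \<alpha> w \<tau> \<and>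
     (let d1 = conf_deriv \<tau>0 \<alpha> (\<lambda>t. comp1 (w t)) \<tau>;
          d2 = conf_deriv \<tau>0 \<alpha> (\<lambda>t. comp2 (w t)) \<tau>;
          d3 = conf_deriv \<tau>0 \<alpha> (\<lambda>t. comp3 (w t)) \<tau>
      in d1 \<le> d2 \<and> d2 \<le> d3 \<and> gH_deriv \<tau>0 \<alpha> w \<tau> = tri d1 d2 d3)"

definition ii_gH_differentiable :: "real \<Rightarrow> real \<Rightarrow> (real \<Rightarrow> fuzzy) \<Rightarrow> real \<Rightarrow> bool" where
  "ii_gH_differentiable \<tau>0 \<alpha> w \<tau> \<longleftrightarrow>
     gH_differentiable \<tau>0 \<alpha> w \<tau> \<and> components_conf_differentiable \<tau>0 \<alpha> w \<tau> \<and>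
     (let d1 = conf_deriv \<tau>0 \<alpha> (\<lambda>t. comp1 (w t)) \<tau>;
          d2 = conf_deriv \<tau>0 \<alpha> (\<lambda>t. comp2 (w t)) \<tau>;
          d3 = conf_deriv \<tau>0 \<alpha> (\<lambda>t. comp3 (w t)) \<tau>
      in d3 \<le> d2 \<and> d2 \<le> d1 \<and> gH_deriv \<tau>0 \<alpha> w \<tau> = tri d3 d2 d1)"

section \<open>Integrals and the conformable Laplace transform\<close>

text \<open>The component integrals are Henstock--Kurzweil integrals.\<close>

definition fuzzy_integrable_on :: "(real \<Rightarrow> fuzzy) \<Rightarrow> real set \<Rightarrow> bool" where
  "fuzzy_integrable_on f S \<longleftrightarrow>
     (\<forall>\<tau>\<in>S. f \<tau> \<in> Triangular) \<and>
     (\<forall>c\<in>{comp1, comp2, comp3}. (\<lambda>\<tau>. c (f \<tau>)) integrable_on S)"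

definition fuzzy_integral :: "real set \<Rightarrow> (real \<Rightarrow> fuzzy) \<Rightarrow> fuzzy" where
  "fuzzy_integral S f =
     tri (integral S (\<lambda>\<tau>. comp1 (f \<tau>))) (integral S (\<lambda>\<tau>. comp2 (f \<tau>)))
       (integral S (\<lambda>\<tau>. comp3 (f \<tau>)))"

text \<open>At \<open>\<tau> = \<tau>\<^sub>0\<close> the weight \<open>(\<tau> - \<tau>\<^sub>0) powr (\<alpha> - 1)\<close> is \<open>0\<close> by the library's convention;
  a single point does not influence the integral.\<close>

definition laplace_integrand ::
    "real \<Rightarrow> real \<Rightarrow> (real \<Rightarrow> fuzzy) \<Rightarrow> real \<Rightarrow> real \<Rightarrow> fuzzy" where
  "laplace_integrand \<tau>0 \<alpha> w s \<tau> =
     ((\<tau> - \<tau>0) powr (\<alpha> - 1) * exp (- s * ((\<tau> - \<tau>0) powr \<alpha> / \<alpha>))) \<odot> w \<tau>"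

definition has_fuzzy_laplace ::
    "real \<Rightarrow> real \<Rightarrow> (real \<Rightarrow> fuzzy) \<Rightarrow> real \<Rightarrow> fuzzy \<Rightarrow> bool" where
  "has_fuzzy_laplace \<tau>0 \<alpha> w s L \<longleftrightarrow>
     (\<forall>R\<ge>\<tau>0. fuzzy_integrable_on (laplace_integrand \<tau>0 \<alpha> w s) {\<tau>0..R}) \<and>
     ((\<lambda>R. fuzzy_integral {\<tau>0..R} (laplace_integrand \<tau>0 \<alpha> w s)) \<longlongrightarrow> L) at_top"

definition fuzzy_laplace_exists ::
    "real \<Rightarrow> real \<Rightarrow> (real \<Rightarrow> fuzzy) \<Rightarrow> real \<Rightarrow> bool" where
  "fuzzy_laplace_exists \<tau>0 \<alpha> w s \<longleftrightarrow> (\<exists>L. has_fuzzy_laplace \<tau>0 \<alpha> w s L)"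

definition fuzzy_laplace :: "real \<Rightarrow> real \<Rightarrow> (real \<Rightarrow> fuzzy) \<Rightarrow> real \<Rightarrow> fuzzy" where
  "fuzzy_laplace \<tau>0 \<alpha> w s = (THE L. has_fuzzy_laplace \<tau>0 \<alpha> w s L)"

end

theory Submission
  imports Defs "HOL-Real_Asymp.Real_Asymp"
begin

text \<open>
  A triangular fuzzy number is determined by its three components, and multiplication by the
  nonnegative Laplace weight, the integral and the limit \<open>R \<rightarrow> \<infinity>\<close> in the Hausdorff metric all act on
  each component separately (\<open>has_fuzzy_laplace_components\<close>). So the fuzzy formulas reduce to the
  derivative rule \<open>D = s F - f(\<tau>\<^sub>0)\<close> for the transforms \<open>F\<close> of a real function \<open>f\<close> and \<open>D\<close> of its
  conformable derivative \<open>d\<close> (\<open>conf_laplace_deriv\<close>).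

  For the latter put \<open>u(\<tau>) = (\<tau> - \<tau>\<^sub>0)\<^sup>\<alpha> / \<alpha>\<close>. A conformable derivative \<open>d(\<tau>)\<close> at \<open>\<tau> > \<tau>\<^sub>0\<close> is the
  ordinary one up to a factor, \<open>f' = u' d\<close>, so \<open>e\<^bsup>-s u\<^esup> f\<close> has derivative
  \<open>u' e\<^bsup>-s u\<^esup> d - s u' e\<^bsup>-s u\<^esup> f\<close>. This holds in the interior of \<open>[\<tau>\<^sub>0, R]\<close>, and right continuity of
  \<open>f\<close> at \<open>\<tau>\<^sub>0\<close> suffices for the fundamental theorem of calculus on the closed interval. Letting
  \<open>R \<rightarrow> \<infinity>\<close> shows that the boundary term \<open>e\<^bsup>-s u(R)\<^esup> f(R)\<close> has some limit \<open>c = D - s F + f(\<tau>\<^sub>0)\<close>.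
  In fact \<open>c = 0\<close>: the integral of \<open>u' e\<^bsup>-s u\<^esup> f\<close> converges,
  whereas that of \<open>u'\<close> diverges, so the factor \<open>e\<^bsup>-s u\<^esup> f\<close> cannot stay away from \<open>0\<close>
  (\<open>limit_nonpos_if_weighted_integral_converges\<close>, used for both signs).

  It remains to read the three scalar equations as one fuzzy equation. For type (i) they say
  \<open>s W = w(\<tau>\<^sub>0) \<oplus> D\<close>. For type (ii) the derivative exchanges the outer components, and the
  equations say \<open>- w(\<tau>\<^sub>0) = - s W \<oplus> D\<close>, the first alternative in the definition of the generalized
  Hukuhara difference.
\<close>

section \<open>Endpoints of level sets\<close>

lemma lo_hi_scale_nonneg:
  assumes "0 \<le> c" "r \<in> {0..1}"
  shows "lo (c \<odot> P) r = c * lo P r" "hi (c \<odot> P) r = c * hi P r"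
proof -
  have r: "0 \<le> r" "r \<le> 1" using assms by auto
  have "rcut (c \<odot> P) r = {c * lo P r..c * hi P r}"
    using rcut_fuzzy_scale[OF assms(2), of c P] assms(1) rcut_eq(2)[OF r, of P]
    by (simp add: rcut_eq[OF r] image_mult_atLeastAtMost_if)
  from lo_hi_eqI[OF this] show "lo (c \<odot> P) r = c * lo P r" "hi (c \<odot> P) r = c * hi P r"
    using rcut_eq(2)[OF r, of P] assms(1) by (auto intro: mult_left_mono)
qed

lemma lo_hi_scale_nonpos:
  assumes "c \<le> 0" "r \<in> {0..1}"
  shows "lo (c \<odot> P) r = c * hi P r" "hi (c \<odot> P) r = c * lo P r"
proof -
  have r: "0 \<le> r" "r \<le> 1" using assms by auto
  have "rcut (c \<odot> P) r = {c * hi P r..c * lo P r}"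
    using rcut_fuzzy_scale[OF assms(2), of c P] assms(1) rcut_eq(2)[OF r, of P]
    by (auto simp add: rcut_eq[OF r] image_mult_atLeastAtMost_if)
  from lo_hi_eqI[OF this] show "lo (c \<odot> P) r = c * hi P r" "hi (c \<odot> P) r = c * lo P r"
    using rcut_eq(2)[OF r, of P] assms(1) by (auto intro: mult_left_mono_neg)
qed

lemma comp_scale_nonneg:
  assumes "0 \<le> c"
  shows "comp1 (c \<odot> P) = c * comp1 P" "comp2 (c \<odot> P) = c * comp2 P"
    "comp3 (c \<odot> P) = c * comp3 P"
  using assms by (simp_all add: comp1_def comp2_def comp3_def lo_hi_scale_nonneg)

lemma lo_hi_le_dist:
  assumes "r \<in> {0..1}"
  shows "\<bar>lo P r - lo Q r\<bar> \<le> dist P Q" "\<bar>hi P r - hi Q r\<bar> \<le> dist P Q"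
  using cSUP_upper[OF assms bdd_above_dist, of P Q] unfolding dist_fuzzy_def by auto

lemma tendsto_lo_hi:
  assumes "(f \<longlongrightarrow> L) F" "r \<in> {0..1}"
  shows "((\<lambda>x. lo (f x) r) \<longlongrightarrow> lo L r) F" "((\<lambda>x. hi (f x) r) \<longlongrightarrow> hi L r) F"
proof -
  show "((\<lambda>x. lo (f x) r) \<longlongrightarrow> lo L r) F"
    by (rule metric_tendsto_imp_tendsto[OF assms(1)])
      (simp add: dist_real_def lo_hi_le_dist[OF assms(2)])
  show "((\<lambda>x. hi (f x) r) \<longlongrightarrow> hi L r) F"
    by (rule metric_tendsto_imp_tendsto[OF assms(1)])
      (simp add: dist_real_def lo_hi_le_dist[OF assms(2)])
qed

lemma tendsto_comp:
  assumes "(f \<longlongrightarrow> L) F"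
  shows "((\<lambda>x. comp1 (f x)) \<longlongrightarrow> comp1 L) F" "((\<lambda>x. comp2 (f x)) \<longlongrightarrow> comp2 L) F"
    "((\<lambda>x. comp3 (f x)) \<longlongrightarrow> comp3 L) F"
  unfolding comp1_def comp2_def comp3_def by (simp_all add: tendsto_lo_hi[OF assms])

section \<open>Triangular fuzzy numbers\<close>

lemma Triangular_comp_le:
  assumes "P \<in> Triangular"
  shows "comp1 P \<le> comp2 P" "comp2 P \<le> comp3 P"
  using assms by (auto simp: Triangular_def comp_tri)

lemma lo_hi_tri:
  assumes "p1 \<le> p2" "p2 \<le> p3" "r \<in> {0..1}"
  shows "lo (tri p1 p2 p3) r = p1 + r * (p2 - p1)" "hi (tri p1 p2 p3) r = p3 - r * (p3 - p2)"
proof -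
  have "r * (p2 - p1) \<le> p2 - p1" "r * (p3 - p2) \<le> p3 - p2"
    using assms by (auto intro!: mult_left_le_one_le)
  then have "p1 + r * (p2 - p1) \<le> p2" "p2 \<le> p3 - r * (p3 - p2)" by simp_all
  then have "p1 + r * (p2 - p1) \<le> p3 - r * (p3 - p2)" by (rule order_trans)
  from lo_hi_eqI[OF rcut_tri[OF assms] this]
  show "lo (tri p1 p2 p3) r = p1 + r * (p2 - p1)" "hi (tri p1 p2 p3) r = p3 - r * (p3 - p2)" .
qed

lemma lo_hi_Triangular:
  assumes "P \<in> Triangular" "r \<in> {0..1}"
  shows "lo P r = comp1 P + r * (comp2 P - comp1 P)" "hi P r = comp3 P - r * (comp3 P - comp2 P)"
  using assms by (auto simp: Triangular_def comp_tri lo_hi_tri)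

text \<open>The endpoints of the cuts of a triangular fuzzy number are affine in the level, with
  coefficients read off from the three components. Endpoints and components converge along with
  the fuzzy numbers, so these equations pass to the limit.\<close>

lemma Triangular_limit:
  assumes lim: "(f \<longlongrightarrow> L) F" and nt: "F \<noteq> bot" and ev: "\<forall>\<^sub>F x in F. f x \<in> Triangular"
  shows "L \<in> Triangular"
proof -
  note c = tendsto_comp[OF lim]
  have le: "comp1 L \<le> comp2 L" "comp2 L \<le> comp3 L"
    using tendsto_le[OF nt c(2) c(1)] tendsto_le[OF nt c(3) c(2)]
      eventually_mono[OF ev Triangular_comp_le(1)] eventually_mono[OF ev Triangular_comp_le(2)]
    by auto
  have "L = tri (comp1 L) (comp2 L) (comp3 L)"
  proof (rule fuzzy_eq_lo_hi)
    fix r :: real assume r: "r \<in> {0..1}"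
    have "((\<lambda>x. comp1 (f x) + r * (comp2 (f x) - comp1 (f x))) \<longlongrightarrow>
        comp1 L + r * (comp2 L - comp1 L)) F"
      by (intro tendsto_intros c)
    moreover have "\<forall>\<^sub>F x in F. comp1 (f x) + r * (comp2 (f x) - comp1 (f x)) = lo (f x) r"
      using ev by eventually_elim (simp add: lo_hi_Triangular[OF _ r])
    ultimately have "((\<lambda>x. lo (f x) r) \<longlongrightarrow> comp1 L + r * (comp2 L - comp1 L)) F"
      by (rule Lim_transform_eventually)
    then have lo: "lo L r = comp1 L + r * (comp2 L - comp1 L)"
      by (rule tendsto_unique[OF nt tendsto_lo_hi(1)[OF lim r]])
    have "((\<lambda>x. comp3 (f x) - r * (comp3 (f x) - comp2 (f x))) \<longlongrightarrow>
        comp3 L - r * (comp3 L - comp2 L)) F"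
      by (intro tendsto_intros c)
    moreover have "\<forall>\<^sub>F x in F. comp3 (f x) - r * (comp3 (f x) - comp2 (f x)) = hi (f x) r"
      using ev by eventually_elim (simp add: lo_hi_Triangular[OF _ r])
    ultimately have "((\<lambda>x. hi (f x) r) \<longlongrightarrow> comp3 L - r * (comp3 L - comp2 L)) F"
      by (rule Lim_transform_eventually)
    then have hi: "hi L r = comp3 L - r * (comp3 L - comp2 L)"
      by (rule tendsto_unique[OF nt tendsto_lo_hi(2)[OF lim r]])
    show "lo L r = lo (tri (comp1 L) (comp2 L) (comp3 L)) r \<and>
        hi L r = hi (tri (comp1 L) (comp2 L) (comp3 L)) r"
      using lo hi le r by (simp add: lo_hi_tri)
  qed
  then show ?thesis using le unfolding Triangular_def by blast
qed

section \<open>Componentwise integrals and Laplace transforms\<close>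

definition laplace_weight :: "real \<Rightarrow> real \<Rightarrow> real \<Rightarrow> real \<Rightarrow> real" where
  "laplace_weight \<tau>0 \<alpha> s \<tau> = (\<tau> - \<tau>0) powr (\<alpha> - 1) * exp (- s * ((\<tau> - \<tau>0) powr \<alpha> / \<alpha>))"

definition has_conf_laplace ::
    "real \<Rightarrow> real \<Rightarrow> (real \<Rightarrow> real) \<Rightarrow> real \<Rightarrow> real \<Rightarrow> bool" where
  "has_conf_laplace \<tau>0 \<alpha> f s F \<longleftrightarrow>
     (\<forall>R\<ge>\<tau>0. (\<lambda>\<tau>. laplace_weight \<tau>0 \<alpha> s \<tau> * f \<tau>) integrable_on {\<tau>0..R}) \<and>
     ((\<lambda>R. integral {\<tau>0..R} (\<lambda>\<tau>. laplace_weight \<tau>0 \<alpha> s \<tau> * f \<tau>)) \<longlongrightarrow> F) at_top"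

lemma has_fuzzy_laplace_fuzzy_laplace:
  assumes "fuzzy_laplace_exists \<tau>0 \<alpha> w s"
  shows "has_fuzzy_laplace \<tau>0 \<alpha> w s (fuzzy_laplace \<tau>0 \<alpha> w s)"
proof -
  obtain L where L: "has_fuzzy_laplace \<tau>0 \<alpha> w s L"
    using assms unfolding fuzzy_laplace_exists_def by blast
  show ?thesis unfolding fuzzy_laplace_def
  proof (rule theI[of _ L])
    show "has_fuzzy_laplace \<tau>0 \<alpha> w s L" by (rule L)
    show "M = L" if "has_fuzzy_laplace \<tau>0 \<alpha> w s M" for M
      using that L tendsto_unique[OF trivial_limit_at_top_linorder]
      unfolding has_fuzzy_laplace_def by blast
  qed
qed

lemma comp_laplace_integrand:
  "comp1 (laplace_integrand \<tau>0 \<alpha> w s \<tau>) = laplace_weight \<tau>0 \<alpha> s \<tau> * comp1 (w \<tau>)"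
  "comp2 (laplace_integrand \<tau>0 \<alpha> w s \<tau>) = laplace_weight \<tau>0 \<alpha> s \<tau> * comp2 (w \<tau>)"
  "comp3 (laplace_integrand \<tau>0 \<alpha> w s \<tau>) = laplace_weight \<tau>0 \<alpha> s \<tau> * comp3 (w \<tau>)"
  by (simp_all add: laplace_integrand_def laplace_weight_def comp_scale_nonneg)

text \<open>By monotonicity of the integral the three component integrals are in increasing order, so
  they are the components of a genuine triangular fuzzy number.\<close>

lemma fuzzy_integral_components:
  assumes "fuzzy_integrable_on f S"
  shows "fuzzy_integral S f \<in> Triangular"
    "comp1 (fuzzy_integral S f) = integral S (\<lambda>\<tau>. comp1 (f \<tau>))"
    "comp2 (fuzzy_integral S f) = integral S (\<lambda>\<tau>. comp2 (f \<tau>))"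
    "comp3 (fuzzy_integral S f) = integral S (\<lambda>\<tau>. comp3 (f \<tau>))"
proof -
  have "integral S (\<lambda>\<tau>. comp1 (f \<tau>)) \<le> integral S (\<lambda>\<tau>. comp2 (f \<tau>))"
    "integral S (\<lambda>\<tau>. comp2 (f \<tau>)) \<le> integral S (\<lambda>\<tau>. comp3 (f \<tau>))"
    using assms by (auto simp: fuzzy_integrable_on_def Triangular_comp_le intro!: integral_le)
  then show "fuzzy_integral S f \<in> Triangular"
    "comp1 (fuzzy_integral S f) = integral S (\<lambda>\<tau>. comp1 (f \<tau>))"
    "comp2 (fuzzy_integral S f) = integral S (\<lambda>\<tau>. comp2 (f \<tau>))"
    "comp3 (fuzzy_integral S f) = integral S (\<lambda>\<tau>. comp3 (f \<tau>))"
    unfolding fuzzy_integral_def Triangular_def by (auto simp: comp_tri)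
qed

text \<open>A fuzzy transform is itself triangular and amounts to three real transforms.\<close>

lemma has_fuzzy_laplace_components:
  assumes "has_fuzzy_laplace \<tau>0 \<alpha> w s L"
  shows "L \<in> Triangular"
    "has_conf_laplace \<tau>0 \<alpha> (\<lambda>\<tau>. comp1 (w \<tau>)) s (comp1 L)"
    "has_conf_laplace \<tau>0 \<alpha> (\<lambda>\<tau>. comp2 (w \<tau>)) s (comp2 L)"
    "has_conf_laplace \<tau>0 \<alpha> (\<lambda>\<tau>. comp3 (w \<tau>)) s (comp3 L)"
proof -
  let ?g = "laplace_integrand \<tau>0 \<alpha> w s"
  have int: "fuzzy_integrable_on ?g {\<tau>0..R}" if "R \<ge> \<tau>0" for R
    using assms that unfolding has_fuzzy_laplace_def by blast
  have lim: "((\<lambda>R. fuzzy_integral {\<tau>0..R} ?g) \<longlongrightarrow> L) at_top"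
    using assms unfolding has_fuzzy_laplace_def by blast
  note c = fuzzy_integral_components[OF int]
  show "L \<in> Triangular"
    by (rule Triangular_limit[OF lim trivial_limit_at_top_linorder])
      (use c(1) in \<open>auto simp: eventually_at_top_linorder\<close>)
  have ev: "\<forall>\<^sub>F R in at_top. R \<ge> \<tau>0" by (rule eventually_ge_at_top)
  note t = tendsto_comp[OF lim]
  show "has_conf_laplace \<tau>0 \<alpha> (\<lambda>\<tau>. comp1 (w \<tau>)) s (comp1 L)"
    unfolding has_conf_laplace_def comp_laplace_integrand(1)[symmetric]
    using int Lim_transform_eventually[OF t(1) eventually_mono[OF ev c(2)]]
    by (auto simp: fuzzy_integrable_on_def)
  show "has_conf_laplace \<tau>0 \<alpha> (\<lambda>\<tau>. comp2 (w \<tau>)) s (comp2 L)"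
    unfolding has_conf_laplace_def comp_laplace_integrand(2)[symmetric]
    using int Lim_transform_eventually[OF t(2) eventually_mono[OF ev c(3)]]
    by (auto simp: fuzzy_integrable_on_def)
  show "has_conf_laplace \<tau>0 \<alpha> (\<lambda>\<tau>. comp3 (w \<tau>)) s (comp3 L)"
    unfolding has_conf_laplace_def comp_laplace_integrand(3)[symmetric]
    using int Lim_transform_eventually[OF t(3) eventually_mono[OF ev c(4)]]
    by (auto simp: fuzzy_integrable_on_def)
qed

section \<open>Conformable and ordinary derivatives\<close>

text \<open>Away from the base point the conformable increment is an ordinary increment in disguise:
  substitute \<open>h = \<epsilon> (\<tau> - \<tau>\<^sub>0)\<^bsup>1 - \<alpha>\<^esup>\<close>.\<close>

lemma has_conf_deriv_imp_DERIV:
  assumes "\<tau>0 < \<tau>" "has_conf_deriv \<tau>0 \<alpha> f \<tau> l"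
  shows "(f has_real_derivative (\<tau> - \<tau>0) powr (\<alpha> - 1) * l) (at \<tau>)"
proof -
  define c where "c = conf_factor \<tau>0 \<alpha> \<tau>"
  have c: "c = (\<tau> - \<tau>0) powr (1 - \<alpha>)" using assms(1) by (simp add: c_def conf_factor_def)
  then have c0: "0 < c" using assms(1) by simp
  have ci: "(\<tau> - \<tau>0) powr (\<alpha> - 1) = 1 / c"
    unfolding c using powr_minus_divide[of "\<tau> - \<tau>0" "1 - \<alpha>"] by simp
  \<comment> \<open>For \<open>\<tau> > \<tau>\<^sub>0\<close> small increments of both signs stay in the domain.\<close>
  have "open {\<epsilon>. \<tau>0 < \<tau> + \<epsilon> * c}" by (intro open_Collect_less continuous_intros)
  then have "0 \<in> interior {\<epsilon>. \<tau>0 \<le> \<tau> + \<epsilon> * c}"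
    using assms(1) by (intro interiorI[of "{\<epsilon>. \<tau>0 < \<tau> + \<epsilon> * c}"]) auto
  then have "conf_filter \<tau>0 \<alpha> \<tau> = at 0"
    unfolding conf_filter_def c_def[symmetric] by (rule at_within_interior)
  then have lim: "((\<lambda>\<epsilon>. (f (\<tau> + \<epsilon> * c) - f \<tau>) / \<epsilon>) \<longlongrightarrow> l) (at 0)"
    using assms(2) by (simp add: has_conf_deriv_def c_def)
  have "filterlim (\<lambda>h. h / c) (at 0) (at 0)"
    by (rule filterlim_atI) (use c0 in \<open>auto intro!: tendsto_eq_intros simp: eventually_at_filter\<close>)
  from filterlim_compose[OF lim this]
  have "((\<lambda>h. 1 / c * ((f (\<tau> + h / c * c) - f \<tau>) / (h / c))) \<longlongrightarrow> 1 / c * l) (at 0)"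
    by (intro tendsto_mult tendsto_const)
  then have "((\<lambda>h. (f (\<tau> + h) - f \<tau>) / h) \<longlongrightarrow> 1 / c * l) (at 0)"
    using c0 by simp
  then show ?thesis unfolding DERIV_def ci .
qed

lemma has_conf_deriv_conf_deriv:
  assumes "\<tau>0 < \<tau>" "has_conf_deriv \<tau>0 \<alpha> f \<tau> l"
  shows "has_conf_deriv \<tau>0 \<alpha> f \<tau> (conf_deriv \<tau>0 \<alpha> f \<tau>)"
  unfolding conf_deriv_def
proof (rule theI[of _ l])
  show "has_conf_deriv \<tau>0 \<alpha> f \<tau> l" by (rule assms(2))
  fix m assume "has_conf_deriv \<tau>0 \<alpha> f \<tau> m"
  then have "(\<tau> - \<tau>0) powr (\<alpha> - 1) * m = (\<tau> - \<tau>0) powr (\<alpha> - 1) * l"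
    using has_conf_deriv_imp_DERIV assms DERIV_unique by blast
  then show "m = l" using assms(1) by simp
qed

section \<open>The derivative rule for real functions\<close>

text \<open>If \<open>c\<close> were positive, \<open>g\<close> would eventually exceed \<open>c / 2\<close>, and the integral of \<open>p g\<close> would grow
  at least like \<open>c / 2\<close> times the unbounded primitive \<open>P\<close> of \<open>p\<close>.\<close>

lemma limit_nonpos_if_weighted_integral_converges:
  fixes g p P :: "real \<Rightarrow> real" and a c F :: real
  assumes lim: "(g \<longlongrightarrow> c) at_top"
    and p: "\<And>x. 0 \<le> p x" "\<And>A R. a \<le> A \<Longrightarrow> A \<le> R \<Longrightarrow> (p has_integral (P R - P A)) {A..R}"
    and P: "filterlim P at_top at_top"
    and int: "\<And>R. a \<le> R \<Longrightarrow> (\<lambda>x. p x * g x) integrable_on {a..R}"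
    and conv: "((\<lambda>R. integral {a..R} (\<lambda>x. p x * g x)) \<longlongrightarrow> F) at_top"
  shows "c \<le> 0"
proof (rule ccontr)
  assume "\<not> c \<le> 0"
  then have c: "c / 2 < c" "0 < c / 2" by auto
  from order_tendstoD(1)[OF lim c(1)] obtain B where B: "\<And>x. x \<ge> B \<Longrightarrow> c / 2 < g x"
    unfolding eventually_at_top_linorder by blast
  define A where "A = max a B"
  let ?I = "\<lambda>R. integral {a..R} (\<lambda>x. p x * g x)"
  have lower: "?I A + c / 2 * (P R - P A) \<le> ?I R" if "A \<le> R" for R
  proof -
    have aA: "a \<le> A" by (simp add: A_def)
    have sub: "(\<lambda>x. p x * g x) integrable_on {A..R}"
      by (rule integrable_on_subinterval[OF int[of R]]) (use aA that in auto)
    have "((\<lambda>x. c / 2 * p x) has_integral c / 2 * (P R - P A)) {A..R}"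
      by (intro has_integral_mult_right p(2) aA that)
    moreover have "c / 2 * p x \<le> p x * g x" if "x \<in> {A..R}" for x
      using mult_left_mono[OF less_imp_le[OF B] p(1), of x x] that by (simp add: A_def mult.commute)
    ultimately have "c / 2 * (P R - P A) \<le> integral {A..R} (\<lambda>x. p x * g x)"
      using has_integral_le[OF _ integrable_integral[OF sub]] by blast
    moreover have "?I A + integral {A..R} (\<lambda>x. p x * g x) = ?I R"
      by (rule Henstock_Kurzweil_Integration.integral_combine) (use aA that int in auto)
    ultimately show ?thesis by linarith
  qed
  have shift: "filterlim (\<lambda>R. P R - P A) at_top at_top"
    using filterlim_tendsto_add_at_top[OF tendsto_const[of "- P A"] P] by simp
  have "filterlim (\<lambda>R. ?I A + c / 2 * (P R - P A)) at_top at_top"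
    by (intro filterlim_tendsto_add_at_top[OF tendsto_const]
        filterlim_tendsto_pos_mult_at_top[OF tendsto_const c(2)] shift)
  then have "filterlim ?I at_top at_top"
    by (rule filterlim_at_top_mono) (rule eventually_mono[OF eventually_ge_at_top[of A] lower])
  then show False
    using not_tendsto_and_filterlim_at_infinity[OF trivial_limit_at_top_linorder conv]
      filterlim_at_top_imp_at_infinity by blast
qed

text \<open>Integration by parts, with the boundary term at infinity removed by the previous lemma.\<close>

lemma conf_laplace_deriv:
  fixes f d :: "real \<Rightarrow> real"
  assumes \<alpha>: "0 < \<alpha>"
    and cont: "continuous (at_right \<tau>0) f"
    and der: "\<And>\<tau>. \<tau>0 < \<tau> \<Longrightarrow> has_conf_deriv \<tau>0 \<alpha> f \<tau> (d \<tau>)"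
    and F: "has_conf_laplace \<tau>0 \<alpha> f s F"
    and D: "has_conf_laplace \<tau>0 \<alpha> d s D"
  shows "D = s * F - f \<tau>0"
proof -
  define u where "u = (\<lambda>\<tau>. (\<tau> - \<tau>0) powr \<alpha> / \<alpha>)"
  define p where "p = (\<lambda>\<tau>. (\<tau> - \<tau>0) powr (\<alpha> - 1))"
  define E where "E = (\<lambda>\<tau>. exp (- s * u \<tau>))"
  have weight: "laplace_weight \<tau>0 \<alpha> s = (\<lambda>\<tau>. p \<tau> * E \<tau>)"
    by (simp add: fun_eq_iff laplace_weight_def p_def E_def u_def)
  have u_deriv: "(u has_real_derivative p \<tau>) (at \<tau>)" if "\<tau>0 < \<tau>" for \<tau>
    unfolding u_def p_def using that \<alpha> by (auto intro!: derivative_eq_intros)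
  have u_cont: "continuous_on {\<tau>0..} u"
    unfolding u_def using \<alpha> by (intro continuous_intros continuous_on_powr') auto
  have f_deriv: "(f has_real_derivative p \<tau> * d \<tau>) (at \<tau>)" if "\<tau>0 < \<tau>" for \<tau>
    unfolding p_def by (rule has_conf_deriv_imp_DERIV[OF that der[OF that]])
  have f_cont: "continuous_on {\<tau>0..} f"
    unfolding continuous_on_eq_continuous_within
  proof
    fix \<tau> assume "\<tau> \<in> {\<tau>0..}"
    then consider "\<tau> = \<tau>0" | "\<tau>0 < \<tau>" by fastforce
    then show "continuous (at \<tau> within {\<tau>0..}) f"
    proof cases
      case 1
      then show ?thesis using cont by (simp add: at_within_Ici_at_right)
    next
      case 2
      then show ?thesis
        using DERIV_isCont[OF f_deriv] continuous_at_imp_continuous_at_within by blast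
    qed
  qed
  have part: "integral {\<tau>0..R} (\<lambda>\<tau>. p \<tau> * E \<tau> * d \<tau>) - s * integral {\<tau>0..R} (\<lambda>\<tau>. p \<tau> * E \<tau> * f \<tau>)
      = E R * f R - f \<tau>0" if R: "\<tau>0 \<le> R" for R
  proof -
    have "((\<lambda>\<tau>. p \<tau> * E \<tau> * d \<tau> - s * (p \<tau> * E \<tau> * f \<tau>)) has_integral E R * f R - E \<tau>0 * f \<tau>0) {\<tau>0..R}"
    proof (rule fundamental_theorem_of_calculus_interior[OF R])
      have "continuous_on {\<tau>0..} (\<lambda>\<tau>. E \<tau> * f \<tau>)"
        unfolding E_def by (intro continuous_intros u_cont f_cont)
      then show "continuous_on {\<tau>0..R} (\<lambda>\<tau>. E \<tau> * f \<tau>)"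
        by (rule continuous_on_subset) auto
      show "((\<lambda>\<tau>. E \<tau> * f \<tau>) has_vector_derivative p x * E x * d x - s * (p x * E x * f x)) (at x)"
        if "x \<in> {\<tau>0<..<R}" for x
        unfolding has_real_derivative_iff_has_vector_derivative[symmetric] E_def
        using that by (auto intro!: derivative_eq_intros u_deriv f_deriv simp: algebra_simps)
    qed
    moreover have "((\<lambda>\<tau>. p \<tau> * E \<tau> * d \<tau> - s * (p \<tau> * E \<tau> * f \<tau>)) has_integral
        integral {\<tau>0..R} (\<lambda>\<tau>. p \<tau> * E \<tau> * d \<tau>) -
        s * integral {\<tau>0..R} (\<lambda>\<tau>. p \<tau> * E \<tau> * f \<tau>)) {\<tau>0..R}"
      using F D R unfolding has_conf_laplace_def weight
      by (intro has_integral_diff has_integral_mult_right integrable_integral) blast+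
    ultimately have "integral {\<tau>0..R} (\<lambda>\<tau>. p \<tau> * E \<tau> * d \<tau>) -
        s * integral {\<tau>0..R} (\<lambda>\<tau>. p \<tau> * E \<tau> * f \<tau>) = E R * f R - E \<tau>0 * f \<tau>0"
      by (rule has_integral_unique[rotated])
    moreover have "E \<tau>0 = 1" using \<alpha> by (simp add: E_def u_def)
    ultimately show ?thesis by simp
  qed
  have limF: "((\<lambda>R. integral {\<tau>0..R} (\<lambda>\<tau>. p \<tau> * E \<tau> * f \<tau>)) \<longlongrightarrow> F) at_top"
    and limD: "((\<lambda>R. integral {\<tau>0..R} (\<lambda>\<tau>. p \<tau> * E \<tau> * d \<tau>)) \<longlongrightarrow> D) at_top"
    using F D unfolding has_conf_laplace_def weight by blast+
  \<comment> \<open>The limit of the boundary term exists because all other terms converge.\<close>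
  define c where "c = D - s * F + f \<tau>0"
  have "((\<lambda>R. integral {\<tau>0..R} (\<lambda>\<tau>. p \<tau> * E \<tau> * d \<tau>) -
      s * integral {\<tau>0..R} (\<lambda>\<tau>. p \<tau> * E \<tau> * f \<tau>) + f \<tau>0) \<longlongrightarrow> c) at_top"
    unfolding c_def by (intro tendsto_intros limF limD)
  then have bdry: "((\<lambda>R. E R * f R) \<longlongrightarrow> c) at_top"
    by (rule Lim_transform_eventually)
      (use part in \<open>auto intro!: eventually_mono[OF eventually_ge_at_top[of \<tau>0]]\<close>)
  have p_int: "(p has_integral u R - u A) {A..R}" if "\<tau>0 \<le> A" "A \<le> R" for A R
  proof (rule fundamental_theorem_of_calculus_interior[OF that(2)])
    show "continuous_on {A..R} u" by (rule continuous_on_subset[OF u_cont]) (use that in auto)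
    show "(u has_vector_derivative p x) (at x)" if "x \<in> {A<..<R}" for x
      using u_deriv[of x] that \<open>\<tau>0 \<le> A\<close> by (simp add: has_real_derivative_iff_has_vector_derivative)
  qed
  have p0: "0 \<le> p x" for x by (simp add: p_def)
  have "filterlim u at_top at_top"
    unfolding u_def using \<alpha> by real_asymp
  note nonpos = limit_nonpos_if_weighted_integral_converges[OF _ p0 p_int this]
  have intF: "(\<lambda>\<tau>. p \<tau> * (E \<tau> * f \<tau>)) integrable_on {\<tau>0..R}" if "\<tau>0 \<le> R" for R
    using F that unfolding has_conf_laplace_def weight by (simp add: mult.assoc)
  \<comment> \<open>The upper bound on the limit is applied to \<open>f\<close> and to \<open>- f\<close>.\<close>
  have "c \<le> 0"
    by (rule nonpos[OF bdry _ _ intF]) (use limF in \<open>auto simp: mult.assoc\<close>)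
  moreover have "- c \<le> 0"
    by (rule nonpos[OF tendsto_minus[OF bdry], of \<tau>0 "- F"])
     (use intF tendsto_minus[OF limF] in \<open>auto simp: mult.assoc integrable_neg_iff\<close>)
  ultimately show ?thesis by (simp add: c_def)
qed

section \<open>The transform of the generalized Hukuhara derivative\<close>

lemma gH_deriv_components_i:
  assumes "i_gH_differentiable \<tau>0 \<alpha> w \<tau>" "\<tau>0 < \<tau>"
  shows "has_conf_deriv \<tau>0 \<alpha> (\<lambda>t. comp1 (w t)) \<tau> (comp1 (gH_deriv \<tau>0 \<alpha> w \<tau>))"
    "has_conf_deriv \<tau>0 \<alpha> (\<lambda>t. comp2 (w t)) \<tau> (comp2 (gH_deriv \<tau>0 \<alpha> w \<tau>))"
    "has_conf_deriv \<tau>0 \<alpha> (\<lambda>t. comp3 (w t)) \<tau> (comp3 (gH_deriv \<tau>0 \<alpha> w \<tau>))"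
  using assms unfolding i_gH_differentiable_def components_conf_differentiable_def Let_def
  by (auto simp: comp_tri intro: has_conf_deriv_conf_deriv)

text \<open>For type (ii) the outer components are exchanged: the lower component of the derivative is the
  derivative of the upper component.\<close>

lemma gH_deriv_components_ii:
  assumes "ii_gH_differentiable \<tau>0 \<alpha> w \<tau>" "\<tau>0 < \<tau>"
  shows "has_conf_deriv \<tau>0 \<alpha> (\<lambda>t. comp3 (w t)) \<tau> (comp1 (gH_deriv \<tau>0 \<alpha> w \<tau>))"
    "has_conf_deriv \<tau>0 \<alpha> (\<lambda>t. comp2 (w t)) \<tau> (comp2 (gH_deriv \<tau>0 \<alpha> w \<tau>))"
    "has_conf_deriv \<tau>0 \<alpha> (\<lambda>t. comp1 (w t)) \<tau> (comp3 (gH_deriv \<tau>0 \<alpha> w \<tau>))"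
  using assms unfolding ii_gH_differentiable_def components_conf_differentiable_def Let_def
  by (auto simp: comp_tri intro: has_conf_deriv_conf_deriv)

text \<open>For \<open>s \<ge> 0\<close> the components of \<open>s \<odot> W\<close> are \<open>s\<close> times those of \<open>W\<close>. For \<open>s < 0\<close> scaling exchanges the
  endpoints of each cut. The equations still hold, because they force every cut of \<open>W\<close> to be a single point: \<open>s\<close> times its lower endpoint is at
  most \<open>s\<close> times its upper endpoint, these being the endpoints of a cut of \<open>v \<oplus> D\<close>, and also at least
  that, as \<open>s\<close> is negative.\<close>

lemma scale_eq_add_if_components:
  assumes T: "W \<in> Triangular" "D \<in> Triangular" "v \<in> Triangular"
    and c: "comp1 D = s * comp1 W - comp1 v" "comp2 D = s * comp2 W - comp2 v"
      "comp3 D = s * comp3 W - comp3 v"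
  shows "s \<odot> W = v \<oplus> D"
proof (rule fuzzy_eq_lo_hi)
  fix r :: real assume r: "r \<in> {0..1}"
  have sum: "lo (v \<oplus> D) r = s * lo W r" "hi (v \<oplus> D) r = s * hi W r"
    by (simp_all add: lo_hi_add[OF r] lo_hi_Triangular[OF _ r] T c algebra_simps)
  show "lo (s \<odot> W) r = lo (v \<oplus> D) r \<and> hi (s \<odot> W) r = hi (v \<oplus> D) r"
  proof (cases "0 \<le> s")
    case True
    then show ?thesis by (simp add: sum lo_hi_scale_nonneg[OF _ r])
  next
    case False
    have "lo (v \<oplus> D) r \<le> hi (v \<oplus> D) r" "lo W r \<le> hi W r"
      using r by (auto intro!: rcut_eq(2))
    then have "s * lo W r = s * hi W r"
      using False mult_left_mono_neg[of "lo W r" "hi W r" s] unfolding sum by linarith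
    then show ?thesis using False by (simp add: sum lo_hi_scale_nonpos[OF _ r])
  qed
qed

text \<open>Negation exchanges the outer components of \<open>v\<close> and of \<open>s \<odot> W\<close>, which matches the exchange in
  the equations for \<open>D\<close>.\<close>

lemma uminus_eq_add_if_components:
  assumes T: "W \<in> Triangular" "D \<in> Triangular" "v \<in> Triangular" and s: "0 \<le> s"
    and c: "comp1 D = s * comp3 W - comp3 v" "comp2 D = s * comp2 W - comp2 v"
      "comp3 D = s * comp1 W - comp1 v"
  shows "(-1) \<odot> v = (-1) \<odot> s \<odot> W \<oplus> D"
  by (rule fuzzy_eq_lo_hi)
    (simp add: lo_hi_add lo_hi_uminus lo_hi_scale_nonneg[OF s] lo_hi_Triangular T c algebra_simps)

theorem theorem4p1:
  fixes \<tau>0 \<alpha> :: real and w :: "real \<Rightarrow> fuzzy"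
  assumes "0 < \<alpha>" and "\<alpha> \<le> 1"
    and "\<And>\<tau>. \<tau> \<ge> \<tau>0 \<Longrightarrow> w \<tau> \<in> Triangular"
    and "continuous (at_right \<tau>0) w"
    and "\<And>\<tau>. \<tau> \<ge> \<tau>0 \<Longrightarrow> gH_differentiable \<tau>0 \<alpha> w \<tau>"
    and "(\<forall>\<tau>\<ge>\<tau>0. i_gH_differentiable \<tau>0 \<alpha> w \<tau>) \<or> (\<forall>\<tau>\<ge>\<tau>0. ii_gH_differentiable \<tau>0 \<alpha> w \<tau>)"
  shows "\<forall>s. fuzzy_laplace_exists \<tau>0 \<alpha> w s \<and> fuzzy_laplace_exists \<tau>0 \<alpha> (gH_deriv \<tau>0 \<alpha> w) s \<longrightarrow>
    ((\<forall>\<tau>\<ge>\<tau>0. i_gH_differentiable \<tau>0 \<alpha> w \<tau>) \<longrightarrow>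
        H_diff_exists (s \<odot> fuzzy_laplace \<tau>0 \<alpha> w s) (w \<tau>0) \<and>
        fuzzy_laplace \<tau>0 \<alpha> (gH_deriv \<tau>0 \<alpha> w) s = s \<odot> fuzzy_laplace \<tau>0 \<alpha> w s \<ominus> w \<tau>0) \<and>
    ((\<forall>\<tau>\<ge>\<tau>0. ii_gH_differentiable \<tau>0 \<alpha> w \<tau>) \<and> 0 \<le> s \<longrightarrow>
        gH_diff_exists ((-1) \<odot> w \<tau>0) ((-1) \<odot> s \<odot> fuzzy_laplace \<tau>0 \<alpha> w s) \<and>
        fuzzy_laplace \<tau>0 \<alpha> (gH_deriv \<tau>0 \<alpha> w) s =
          (-1) \<odot> w \<tau>0 \<ominus>\<^sub>g\<^sub>H (-1) \<odot> s \<odot> fuzzy_laplace \<tau>0 \<alpha> w s)"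
proof (intro allI impI conjI; elim conjE)
  note T0 = assms(3)[OF order_refl]
  have cont: "continuous (at_right \<tau>0) (\<lambda>\<tau>. comp1 (w \<tau>))"
    "continuous (at_right \<tau>0) (\<lambda>\<tau>. comp2 (w \<tau>))" "continuous (at_right \<tau>0) (\<lambda>\<tau>. comp3 (w \<tau>))"
    using assms(4) unfolding continuous_within by (auto intro: tendsto_comp)
  note rule = conf_laplace_deriv[OF assms(1)]
  fix s
  let ?W = "fuzzy_laplace \<tau>0 \<alpha> w s" and ?D = "fuzzy_laplace \<tau>0 \<alpha> (gH_deriv \<tau>0 \<alpha> w) s"
  assume "fuzzy_laplace_exists \<tau>0 \<alpha> w s" "fuzzy_laplace_exists \<tau>0 \<alpha> (gH_deriv \<tau>0 \<alpha> w) s"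
  note W = has_fuzzy_laplace_components[OF has_fuzzy_laplace_fuzzy_laplace[OF this(1)]]
    and D = has_fuzzy_laplace_components[OF has_fuzzy_laplace_fuzzy_laplace[OF this(2)]]
  {
    assume i: "\<forall>\<tau>\<ge>\<tau>0. i_gH_differentiable \<tau>0 \<alpha> w \<tau>"
    have d: "i_gH_differentiable \<tau>0 \<alpha> w \<tau>" if "\<tau>0 < \<tau>" for \<tau> using i that by simp
    note der = gH_deriv_components_i[OF d]
    have "s \<odot> ?W = w \<tau>0 \<oplus> ?D"
      by (rule scale_eq_add_if_components[OF W(1) D(1) T0
            rule[OF cont(1) der(1) W(2) D(2)] rule[OF cont(2) der(2) W(3) D(3)]
            rule[OF cont(3) der(3) W(4) D(4)]])
    then show "H_diff_exists (s \<odot> ?W) (w \<tau>0)" "?D = s \<odot> ?W \<ominus> w \<tau>0"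
      using H_diff_eqI unfolding H_diff_exists_def by auto
  next
    assume ii: "\<forall>\<tau>\<ge>\<tau>0. ii_gH_differentiable \<tau>0 \<alpha> w \<tau>" and s: "0 \<le> s"
    have d: "ii_gH_differentiable \<tau>0 \<alpha> w \<tau>" if "\<tau>0 < \<tau>" for \<tau> using ii that by simp
    note der = gH_deriv_components_ii[OF d]
    have "(-1) \<odot> w \<tau>0 = (-1) \<odot> s \<odot> ?W \<oplus> ?D"
      by (rule uminus_eq_add_if_components[OF W(1) D(1) T0 s
            rule[OF cont(3) der(1) W(4) D(2)] rule[OF cont(2) der(2) W(3) D(3)]
            rule[OF cont(1) der(3) W(2) D(4)]])
    then show "gH_diff_exists ((-1) \<odot> w \<tau>0) ((-1) \<odot> s \<odot> ?W)"
      "?D = (-1) \<odot> w \<tau>0 \<ominus>\<^sub>g\<^sub>H (-1) \<odot> s \<odot> ?W"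
      using gH_diff_eqI unfolding gH_diff_exists_def by metis+
  }
qed

end
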